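(* Let $S\subseteq\mathbb{N}^p$ be a special strong affine semigroup minimally generated by $E\sqcup A$, where $E=\operatorname{Mult}(S)=\{e_1,\dots,e_t\}$ and $A=\operatorname{msg}(S)\setminus E=\{a_1,\dots,a_r\}\neq\emptyset$. Then the following monomials of $\mathbb{K}[x_1,\dots,x_t,y_1,\dots,y_r]$ are indispensable (for the semigroup ideal $I_S$): 1. $y_iy_j$ for $i,j\in\{1,\dots,r\}$. 2. $X^\omega y_j$ for any $j\in\{1,\dots,r\}$ and $\omega\in\operatorname{Hilb}(T_j)$. Moreover, they are the unique indispensable monomials involving at least one variable in $\{y_1,\dots,y_r\}$.
   Context: Here $p\ge1$ and $\mathbb{N}$ is the set of non-negative integers. An affine semigroup $S\subseteq\mathbb{N}^p$ is a finitely generated submonoid of $\mathbb{N}^p$; $\operatorname{msg}(S)$ is its unique minimal generating set; $\mathcal{C}(S)$ is the set of points of $\mathbb{N}^p$ lying in the cone of non-negative real combinations of $\operatorname{msg}(S)$. The set of multiplicities $\operatorname{Mult}(S)\subseteq\operatorname{msg}(S)$ is the set of minimal elements of $S\setminus\{0\}$ for the order $x\le_{\mathcal{C}(S)}y\iff y-x\in\mathcal{C}(S)$. $S$ is special strong if for all $x,y\in S\setminus\{0\}$ (possibly equal) there is $e\in\operatorname{Mult}(S)$ with $x+y-e\in S$. Let $\mathbb{K}$ be a field. The monomial $X^\alpha Y^\beta=x_1^{\alpha_1}\cdots x_t^{\alpha_t}y_1^{\beta_1}\cdots y_r^{\beta_r}$ has $S$-degree $\sum_{i=1}^t\alpha_ie_i+\sum_{i=1}^r\beta_ia_i$.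 The semigroup ideal $I_S\subset\mathbb{K}[x_1,\dots,x_t,y_1,\dots,y_r]$ is the ideal generated by all binomials $X^\alpha Y^\beta-X^\gamma Y^\delta$ whose two monomials have the same $S$-degree. It has minimal generating sets consisting of such binomials; a monomial is indispensable if it appears (as one of the two monomials of some binomial) in every minimal binomial generating set of $I_S$. For $m\in S$, $C_m$ is the set of monomials of $S$-degree $m$, and $\sharp$ denotes cardinality. For $j\in\{1,\dots,r\}$, $$T_j=\Big\{\alpha\in\mathbb{N}^t\mid\sharp C_{\sum_{i=1}^t\alpha_ie_i+a_j}\ge2\text{ and }\sharp C_{\sum_{i=1}^t\alpha_ie_i}=1\Big\}.$$ For $L\subseteq\mathbb{N}^l$, $\operatorname{Hilb}(L)$ denotes the (finite) set of minimal elements of $L$ for the componentwise partial order on $\mathbb{N}^l$. *)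

theory Defs
  imports "HOL-Analysis.Analysis" "HOL-Library.Poly_Mapping"
begin

section \<open>Affine semigroups\<close>

definition submonoid :: "'a::monoid_add set \<Rightarrow> bool" where
  "submonoid M \<longleftrightarrow> 0 \<in> M \<and> (\<forall>x\<in>M. \<forall>y\<in>M. x + y \<in> M)"

definition affine_semigroup :: "(nat ^ 'p) set \<Rightarrow> bool" where
  "affine_semigroup S \<longleftrightarrow> submonoid S \<and> (\<exists>G. finite G \<and> submonoid hull G = S)"

definition minimal_generating_set :: "'a::monoid_add set \<Rightarrow> 'a set \<Rightarrow> bool" where
  "minimal_generating_set S G \<longleftrightarrow>
     submonoid hull G = S \<and> (\<forall>G'. G' \<subset> G \<longrightarrow> submonoid hull G' \<noteq> S)"

text \<open>The description is proper for submonoids of \<open>nat ^ 'p\<close>: see \<open>minimal_generating_set_msg\<close> below.\<close>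

definition msg :: "'a::monoid_add set \<Rightarrow> 'a set" where
  "msg S = (THE G. minimal_generating_set S G)"

definition real_vec :: "nat ^ 'p \<Rightarrow> real ^ 'p" where
  "real_vec x = (\<chi> i. real (x $ i))"

definition cone_points :: "(nat ^ 'p) set \<Rightarrow> (nat ^ 'p) set" where
  "cone_points S = {z. \<exists>c. (\<forall>g\<in>msg S. 0 \<le> c g) \<and>
     real_vec z = (\<Sum>g\<in>msg S. c g *\<^sub>R real_vec g)}"

text \<open>Since \<open>cone_points S\<close> consists of vectors of natural numbers, \<open>y - x\<close> (taken over the
  integers) belongs to it iff \<open>y = x + z\<close> for some \<open>z \<in> cone_points S\<close>; this avoids truncated
  subtraction. The same device is used for \<open>x + y - e \<in> S\<close> in \<open>special_strong\<close>.\<close>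

definition cone_le :: "(nat ^ 'p) set \<Rightarrow> nat ^ 'p \<Rightarrow> nat ^ 'p \<Rightarrow> bool" where
  "cone_le S x y \<longleftrightarrow> (\<exists>z\<in>cone_points S. y = x + z)"

definition Mult :: "(nat ^ 'p) set \<Rightarrow> (nat ^ 'p) set" where
  "Mult S = {x \<in> S - {0}. \<forall>y\<in>S - {0}. cone_le S y x \<longrightarrow> y = x}"

definition special_strong :: "(nat ^ 'p) set \<Rightarrow> bool" where
  "special_strong S \<longleftrightarrow>
     (\<forall>x\<in>S - {0}. \<forall>y\<in>S - {0}. \<exists>e\<in>Mult S. \<exists>s\<in>S. x + y = e + s)"

definition Hilb :: "(nat ^ 'l) set \<Rightarrow> (nat ^ 'l) set" where
  "Hilb L = {x \<in> L. \<forall>y\<in>L. y \<le> x \<longrightarrow> y = x}"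


section \<open>Monomials and the semigroup ideal\<close>

text \<open>The variables are indexed by \<open>'t + 'r\<close>: \<open>Inl i\<close> is the index of \<open>x\<^sub>i\<close> and \<open>Inr j\<close>
  that of \<open>y\<^sub>j\<close>. A monomial is given by its exponents, so that the product of monomials is
  addition of type \<open>('t, 'r) mon\<close>; the multiplication of \<open>('t, 'r, 'k) pol\<close> is the
  convolution product, i.e. this type is the ring of polynomials over \<open>'k\<close>.\<close>

type_synonym ('t, 'r) mon = "('t + 'r) \<Rightarrow>\<^sub>0 nat"
type_synonym ('t, 'r, 'k) pol = "('t, 'r) mon \<Rightarrow>\<^sub>0 'k"

definition xpow :: "nat ^ 't \<Rightarrow> ('t::finite, 'r) mon" where
  "xpow \<alpha> = (\<Sum>i\<in>UNIV. Poly_Mapping.single (Inl i) (\<alpha> $ i))"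

definition yvar :: "'r \<Rightarrow> ('t, 'r) mon" where
  "yvar j = Poly_Mapping.single (Inr j) 1"

definition monom_pol :: "('t, 'r) mon \<Rightarrow> ('t, 'r, 'k::field) pol" where
  "monom_pol u = Poly_Mapping.single u 1"

definition sdeg :: "('t::finite \<Rightarrow> nat ^ 'p) \<Rightarrow> ('r::finite \<Rightarrow> nat ^ 'p) \<Rightarrow> ('t, 'r) mon \<Rightarrow> nat ^ 'p" where
  "sdeg e a u = (\<Sum>i\<in>UNIV. Poly_Mapping.lookup u (Inl i) *s e i) +
                (\<Sum>j\<in>UNIV. Poly_Mapping.lookup u (Inr j) *s a j)"

definition C :: "('t::finite \<Rightarrow> nat ^ 'p) \<Rightarrow> ('r::finite \<Rightarrow> nat ^ 'p) \<Rightarrow> nat ^ 'p \<Rightarrow> ('t, 'r) mon set" where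
  "C e a m = {u. sdeg e a u = m}"

text \<open>\<open>card\<close> is harmless here: \<open>C e a m\<close> is finite as soon as all \<open>e i\<close>, \<open>a j\<close> are nonzero.\<close>

definition T :: "('t::finite \<Rightarrow> nat ^ 'p) \<Rightarrow> ('r::finite \<Rightarrow> nat ^ 'p) \<Rightarrow> 'r \<Rightarrow> (nat ^ 't) set" where
  "T e a j = {\<alpha>. card (C e a ((\<Sum>i\<in>UNIV. \<alpha> $ i *s e i) + a j)) \<ge> 2 \<and>
                 card (C e a (\<Sum>i\<in>UNIV. \<alpha> $ i *s e i)) = 1}"

interpretation ring_ideal: module "(*) :: 'a::comm_ring_1 \<Rightarrow> 'a \<Rightarrow> 'a"
  by unfold_locales (simp_all add: algebra_simps)

definition ideal :: "'a::comm_ring_1 set \<Rightarrow> 'a set" where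
  "ideal B = ring_ideal.span B"

definition binomials ::
  "('t::finite \<Rightarrow> nat ^ 'p) \<Rightarrow> ('r::finite \<Rightarrow> nat ^ 'p) \<Rightarrow> ('t, 'r, 'k::field) pol set" where
  "binomials e a = {monom_pol u - monom_pol v | u v. sdeg e a u = sdeg e a v}"

definition semigroup_ideal ::
  "('t::finite \<Rightarrow> nat ^ 'p) \<Rightarrow> ('r::finite \<Rightarrow> nat ^ 'p) \<Rightarrow> ('t, 'r, 'k::field) pol set" where
  "semigroup_ideal e a = ideal (binomials e a)"

definition minimal_binomial_generating_set ::
  "('t::finite \<Rightarrow> nat ^ 'p) \<Rightarrow> ('r::finite \<Rightarrow> nat ^ 'p) \<Rightarrow> ('t, 'r, 'k::field) pol set \<Rightarrow> bool" where
  "minimal_binomial_generating_set e a B \<longleftrightarrow>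
     B \<subseteq> binomials e a \<and> ideal B = semigroup_ideal e a \<and>
     (\<forall>B'. B' \<subset> B \<longrightarrow> ideal B' \<noteq> semigroup_ideal e a)"

text \<open>A nonzero binomial \<open>monom_pol u - monom_pol v\<close> has \<open>keys\<close> equal to \<open>{u, v}\<close>; the zero
  binomial belongs to no minimal generating set. The \<open>itself\<close> argument fixes the field of
  coefficients.\<close>

definition indispensable ::
  "'k::field itself \<Rightarrow> ('t::finite \<Rightarrow> nat ^ 'p) \<Rightarrow> ('r::finite \<Rightarrow> nat ^ 'p) \<Rightarrow> ('t, 'r) mon \<Rightarrow> bool" where
  "indispensable _ e a u \<longleftrightarrow>
     (\<forall>B :: ('t, 'r, 'k) pol set. minimal_binomial_generating_set e a B \<longrightarrow>
        (\<exists>b\<in>B. u \<in> Poly_Mapping.keys b))"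


section \<open>Well-definedness of \<open>msg\<close>\<close>

lemma submonoid_hull: "submonoid (submonoid hull G)"
  by (rule hull_in) (auto simp: submonoid_def)

lemma minimal_generating_set_unique:
  fixes S :: "(nat ^ 'p) set"
  assumes "submonoid S"
  shows "minimal_generating_set S G \<longleftrightarrow>
    G = {x \<in> S - {0}. \<not> (\<exists>y\<in>S - {0}. \<exists>z\<in>S - {0}. x = y + z)}"
proof -
  define I where "I = {x \<in> S - {0}. \<not> (\<exists>y\<in>S - {0}. \<exists>z\<in>S - {0}. x = y + z)}"
  define wt :: "nat ^ 'p \<Rightarrow> nat" where "wt x = (\<Sum>i\<in>UNIV. x $ i)" for x
  have wt_add: "wt (x + y) = wt x + wt y" for x y
    by (simp add: wt_def sum.distrib)
  have wt_pos: "wt x > 0" if "x \<noteq> 0" for x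
  proof (rule ccontr)
    assume "\<not> wt x > 0"
    then have "\<forall>i. x $ i = 0" by (simp add: wt_def)
    then have "x = 0" by (simp add: vec_eq_iff)
    with that show False by simp
  qed
  have sub: "I \<subseteq> G" if G: "submonoid hull G = S" for G
  proof
    fix x assume x: "x \<in> I"
    show "x \<in> G"
    proof (rule ccontr)
      assume nx: "x \<notin> G"
      have "submonoid (S - {x})"
        unfolding submonoid_def
      proof (intro conjI ballI)
        show "0 \<in> S - {x}" using x assms by (auto simp: I_def submonoid_def)
      next
        fix y z assume yz: "y \<in> S - {x}" "z \<in> S - {x}"
        then have "y + z \<in> S" using assms by (auto simp: submonoid_def)
        moreover have "y + z \<noteq> x"
        proof (cases "y = 0 \<or> z = 0")
          case True then show ?thesis using yz by auto
        next
          case False then show ?thesis using yz x unfolding I_def by blast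
        qed
        ultimately show "y + z \<in> S - {x}" by simp
      qed
      moreover have "G \<subseteq> S - {x}" using nx G hull_subset[of G submonoid] by auto
      ultimately have "submonoid hull G \<subseteq> S - {x}" by (rule hull_minimal[rotated])
      then show False using G x by (auto simp: I_def)
    qed
  qed
  have "x \<in> submonoid hull I" if "x \<in> S" for x
    using that
  proof (induction "wt x" arbitrary: x rule: less_induct)
    case less
    show ?case
    proof (cases "x = 0 \<or> x \<in> I")
      case True
      then show ?thesis using submonoid_hull[of I] hull_subset[of I submonoid]
        by (auto simp: submonoid_def)
    next
      case False
      then obtain y z where yz: "y \<in> S" "z \<in> S" "y \<noteq> 0" "z \<noteq> 0" "x = y + z"
        using less.prems unfolding I_def by blast
      then have "wt y < wt x" "wt z < wt x" using wt_pos wt_add by auto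
      then show ?thesis using less.hyps yz submonoid_hull[of I] by (auto simp: submonoid_def)
    qed
  qed
  moreover have "submonoid hull I \<subseteq> S"
    by (rule hull_minimal) (auto simp: I_def assms)
  ultimately have gen: "submonoid hull I = S" by auto
  show ?thesis
    unfolding I_def[symmetric] minimal_generating_set_def
  proof
    assume G: "submonoid hull G = S \<and> (\<forall>G'\<subset>G. submonoid hull G' \<noteq> S)"
    then show "G = I" using sub gen by blast
  next
    assume "G = I"
    then show "submonoid hull G = S \<and> (\<forall>G'\<subset>G. submonoid hull G' \<noteq> S)"
      using sub gen by blast
  qed
qed

lemma minimal_generating_set_msg:
  fixes S :: "(nat ^ 'p) set"
  assumes "submonoid S"
  shows "minimal_generating_set S (msg S)"
  unfolding msg_def using minimal_generating_set_unique[OF assms] by (metis (no_types, lifting) theI)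

end

theory Submission
  imports Defs
begin

text \<open>A monomial is indispensable iff it is minimal under divisibility among the monomials that share
  their \<open>S\<close>-degree with another monomial. Such a minimal monomial can only be produced by a generator
  in which it occurs. Conversely, call two monomials equivalent if they are linked by multiples of
  binomials of strictly smaller degree; choosing one representative per class and, in each degree,
  a star of binomials joining the representatives gives a minimal generating set, and a non-minimal
  monomial with a nontrivial fibre is never alone in its class, so it can be avoided as a
  representative. For a special strong semigroup every \<open>y\<^sub>iy\<^sub>j\<close> has a nontrivial fibre, while the
  irreducibility of \<open>a\<^sub>j\<close> makes the fibre of \<open>y\<^sub>j\<close> trivial; hence the minimal monomials involving
  some \<open>y\<close> are the \<open>y\<^sub>iy\<^sub>j\<close> and the minimal ones of the form \<open>X\<^sup>\<omega>y\<^sub>j\<close>.\<close>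

section \<open>Degrees and fibres of monomials\<close>

definition nontrivial_fibre ::
  "('t::finite \<Rightarrow> nat ^ 'p) \<Rightarrow> ('r::finite \<Rightarrow> nat ^ 'p) \<Rightarrow> ('t, 'r) mon \<Rightarrow> bool" where
  "nontrivial_fibre e a u \<longleftrightarrow> (\<exists>v. v \<noteq> u \<and> sdeg e a v = sdeg e a u)"

text \<open>These are the minimal generators of the monomial ideal spanned by the monomials with
  nontrivial fibre; \<open>w\<close> is the cofactor of the divisor \<open>p\<close>.\<close>

definition minimal_nontrivial ::
  "('t::finite \<Rightarrow> nat ^ 'p) \<Rightarrow> ('r::finite \<Rightarrow> nat ^ 'p) \<Rightarrow> ('t, 'r) mon \<Rightarrow> bool" where
  "minimal_nontrivial e a u \<longleftrightarrow> nontrivial_fibre e a u \<and>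
     (\<forall>w p. u = w + p \<and> nontrivial_fibre e a p \<longrightarrow> w = 0)"

lemma sdeg_0 [simp]: "sdeg e a 0 = 0"
  by (simp add: sdeg_def vec_eq_iff)

lemma sdeg_add: "sdeg e a (u + v) = sdeg e a u + sdeg e a v"
  by (simp add: sdeg_def vec_eq_iff lookup_add algebra_simps sum.distrib)

lemma sdeg_nth:
  "sdeg e a u $ k =
     (\<Sum>i\<in>UNIV. Poly_Mapping.lookup u (Inl i) * e i $ k) +
     (\<Sum>j\<in>UNIV. Poly_Mapping.lookup u (Inr j) * a j $ k)"
  by (simp add: sdeg_def)

lemma sdeg_single_Inl [simp]: "sdeg e a (Poly_Mapping.single (Inl i) n) = n *s e i"
  by (simp add: vec_eq_iff sdeg_nth lookup_single when_def if_distrib[of "\<lambda>x. x * _"] cong: if_cong)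

lemma sdeg_single_Inr [simp]: "sdeg e a (Poly_Mapping.single (Inr j) n) = n *s a j"
  by (simp add: vec_eq_iff sdeg_nth lookup_single when_def if_distrib[of "\<lambda>x. x * _"] cong: if_cong)

lemma sdeg_yvar [simp]: "sdeg e a (yvar j) = a j"
  by (simp add: yvar_def vec_eq_iff)

lemma lookup_xpow [simp]:
  "Poly_Mapping.lookup (xpow \<alpha>) (Inl i) = \<alpha> $ i"
  "Poly_Mapping.lookup (xpow \<alpha>) (Inr j) = 0"
  by (simp_all add: xpow_def lookup_sum lookup_single when_def)

lemma lookup_yvar [simp]:
  "Poly_Mapping.lookup (yvar j) (Inl i) = 0"
  "Poly_Mapping.lookup (yvar j) (Inr k) = (if j = k then 1 else 0)"
  by (simp_all add: yvar_def lookup_single when_def)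

lemma yvar_neq_0 [simp]: "yvar j \<noteq> 0"
  by (metis lookup_yvar(2) lookup_zero zero_neq_one)

lemma sdeg_xpow: "sdeg e a (xpow \<alpha>) = (\<Sum>i\<in>UNIV. \<alpha> $ i *s e i)"
  by (simp add: sdeg_def vec_eq_iff)

lemma mon_eqI:
  fixes u v :: "('t, 'r) mon"
  assumes "\<And>i. Poly_Mapping.lookup u (Inl i) = Poly_Mapping.lookup v (Inl i)"
    and "\<And>j. Poly_Mapping.lookup u (Inr j) = Poly_Mapping.lookup v (Inr j)"
  shows "u = v"
  using assms by (intro poly_mapping_eqI) (metis sum.exhaust_sel)

lemma mon_splitI:
  fixes u v :: "'x \<Rightarrow>\<^sub>0 nat"
  assumes "\<And>x. Poly_Mapping.lookup v x \<le> Poly_Mapping.lookup u x"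
  obtains w where "u = w + v"
proof
  show "u = (u - v) + v"
    using assms by (intro poly_mapping_eqI) (simp add: lookup_add lookup_minus)
qed

lemma mon_neq_0_split:
  fixes u :: "('t, 'r) mon"
  assumes "u \<noteq> 0"
  obtains x w where "u = w + Poly_Mapping.single x 1"
proof -
  obtain x where x: "Poly_Mapping.lookup u x \<noteq> 0"
    using assms by (metis lookup_zero poly_mapping_eqI)
  have "Poly_Mapping.lookup (Poly_Mapping.single x 1) y \<le> Poly_Mapping.lookup u y" for y
    using x by (auto simp: lookup_single when_def Suc_le_eq)
  then show thesis using mon_splitI that by metis
qed

text \<open>A second monomial in the fibre of \<open>p\<close> can be multiplied by
  \<open>w\<close>, and cancellation keeps it distinct. Hence trivial fibres pass to
  divisors.\<close>

lemma nontrivial_fibre_add: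
  assumes "nontrivial_fibre e a p"
  shows "nontrivial_fibre e a (w + p)"
  using assms unfolding nontrivial_fibre_def by (metis add_left_cancel sdeg_add)


section \<open>Indispensable monomials as minimal monomials with a nontrivial fibre\<close>

lemma keys_monom_diff:
  assumes "u \<noteq> v"
  shows "Poly_Mapping.keys (monom_pol u - monom_pol v :: ('t, 'r, 'k::field) pol) = {u, v}"
  using assms
  by (auto simp: monom_pol_def in_keys_iff lookup_minus lookup_single when_def split: if_splits)

lemma monom_pol_mult: "monom_pol u * monom_pol v = monom_pol (u + v)"
  by (simp add: monom_pol_def mult_single)

text \<open>The keys of a product are sums of keys of the factors, so divisibility by a key of a
  generator survives the formation of ideal combinations.\<close>

lemma keys_ideal_divisible:
  fixes f :: "('t, 'r, 'k::field) pol"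
  assumes "f \<in> ideal B" "v \<in> Poly_Mapping.keys f"
  shows "\<exists>b\<in>B. \<exists>p\<in>Poly_Mapping.keys b. \<exists>w. v = w + p"
proof -
  have "f \<in> ring_ideal.span B" using assms(1) by (simp add: ideal_def)
  then have "\<forall>v\<in>Poly_Mapping.keys f. \<exists>b\<in>B. \<exists>p\<in>Poly_Mapping.keys b. \<exists>w. v = w + p"
  proof (induction rule: ring_ideal.span_induct_alt)
    case base
    then show ?case by simp
  next
    case (step c b f)
    show ?case
    proof
      fix v assume "v \<in> Poly_Mapping.keys (c * b + f)"
      then have "v \<in> Poly_Mapping.keys (c * b) \<or> v \<in> Poly_Mapping.keys f"
        using Poly_Mapping.keys_add[of "c * b" f] by blast
      then show "\<exists>b\<in>B. \<exists>p\<in>Poly_Mapping.keys b. \<exists>w. v = w + p"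
        using step keys_mult[of c b] by blast
    qed
  qed
  then show ?thesis using assms(2) by blast
qed

lemma binomial_keys_nontrivial:
  assumes "b \<in> binomials e a" "p \<in> Poly_Mapping.keys b"
  shows "nontrivial_fibre e a p"
proof -
  obtain u v where b: "b = monom_pol u - monom_pol v" and d: "sdeg e a u = sdeg e a v"
    using assms(1) by (auto simp: binomials_def)
  have "u \<noteq> v" using b assms(2) by auto
  then have "p = u \<or> p = v" using b assms(2) keys_monom_diff by blast
  then show ?thesis using d \<open>u \<noteq> v\<close> unfolding nontrivial_fibre_def by metis
qed

text \<open>Since \<open>u\<close> occurs in a binomial of the ideal, some key of a generator
  divides it; that key has a nontrivial fibre, and minimality identifies it with
  \<open>u\<close>.\<close>

lemma minimal_nontrivial_imp_indispensable:
  fixes e :: "'t::finite \<Rightarrow> nat ^ 'p" and a :: "'r::finite \<Rightarrow> nat ^ 'p"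
  assumes "minimal_nontrivial e a u"
  shows "indispensable TYPE('k::field) e a u"
  unfolding indispensable_def
proof (intro allI impI)
  fix B :: "('t, 'r, 'k) pol set"
  assume "minimal_binomial_generating_set e a B"
  then have B: "B \<subseteq> binomials e a" "ideal B = semigroup_ideal e a"
    by (auto simp: minimal_binomial_generating_set_def)
  obtain v where v: "v \<noteq> u" "sdeg e a v = sdeg e a u"
    using assms by (auto simp: minimal_nontrivial_def nontrivial_fibre_def)
  have "monom_pol u - monom_pol v \<in> (binomials e a :: ('t, 'r, 'k) pol set)"
    using v by (force simp: binomials_def)
  then have "monom_pol u - monom_pol v \<in> ideal B"
    unfolding B(2) unfolding semigroup_ideal_def ideal_def by (rule ring_ideal.span_base)
  moreover have "u \<in> Poly_Mapping.keys (monom_pol u - monom_pol v :: ('t, 'r, 'k) pol)"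
    using v by (simp add: keys_monom_diff)
  ultimately obtain b p w where b: "b \<in> B" "p \<in> Poly_Mapping.keys b" "u = w + p"
    using keys_ideal_divisible by blast
  then have "w = 0"
    using assms B(1) binomial_keys_nontrivial unfolding minimal_nontrivial_def by blast
  then show "\<exists>b\<in>B. u \<in> Poly_Mapping.keys b" using b by auto
qed

text \<open>A step links two monomials of one degree that share the factor \<open>w\<close>, so the
  classes of the closure are the connected components of the fibres under having a common
  variable.\<close>

definition lower_step ::
  "('t::finite \<Rightarrow> nat ^ 'p) \<Rightarrow> ('r::finite \<Rightarrow> nat ^ 'p) \<Rightarrow> (('t, 'r) mon \<times> ('t, 'r) mon) set" where
  "lower_step e a = {(w + p, w + q) | w p q. w \<noteq> 0 \<and> sdeg e a p = sdeg e a q}"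

lemma sym_lower_step: "sym ((lower_step e a)\<^sup>*)"
  by (rule sym_rtrancl, rule symI) (force simp: lower_step_def)

lemma lower_step_sdeg:
  assumes "(u, v) \<in> (lower_step e a)\<^sup>*"
  shows "sdeg e a u = sdeg e a v"
  using assms by induction (auto simp: lower_step_def sdeg_add)

lemma lower_stepI:
  assumes "w \<noteq> 0" "sdeg e a p = sdeg e a q"
  shows "(w + p, w + q) \<in> (lower_step e a)\<^sup>*"
  using assms by (intro r_into_rtrancl) (auto simp: lower_step_def)

text \<open>For \<open>K\<close> a class of \<open>(lower_step e a)\<^sup>*\<close>, this linear functional vanishes on the ideal generated
  by all binomials of the star except the one that joins \<open>K\<close> to the centre.\<close>

definition coeff_sum :: "'x set \<Rightarrow> ('x \<Rightarrow>\<^sub>0 'k::field) \<Rightarrow> 'k" where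
  "coeff_sum K f = (\<Sum>v\<in>Poly_Mapping.keys f. if v \<in> K then Poly_Mapping.lookup f v else 0)"

lemma coeff_sum_superset:
  assumes "finite A" "Poly_Mapping.keys f \<subseteq> A"
  shows "coeff_sum K f = (\<Sum>v\<in>A. if v \<in> K then Poly_Mapping.lookup f v else 0)"
  unfolding coeff_sum_def
  by (rule sum.mono_neutral_left) (use assms in \<open>auto simp: in_keys_iff\<close>)

lemma coeff_sum_add: "coeff_sum K (f + g) = coeff_sum K f + coeff_sum K g"
proof -
  let ?A = "Poly_Mapping.keys f \<union> Poly_Mapping.keys g"
  have "Poly_Mapping.keys (f + g) \<subseteq> ?A" by (rule Poly_Mapping.keys_add)
  then show ?thesis
    by (subst (1 2 3) coeff_sum_superset[of ?A])
      (auto simp: lookup_add sum.distrib[symmetric] intro!: sum.cong)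
qed

lemma coeff_sum_single: "coeff_sum K (Poly_Mapping.single u c) = (if u \<in> K then c else 0)"
  by (subst coeff_sum_superset[of "{u}"]) auto

lemma coeff_sum_0 [simp]: "coeff_sum K 0 = 0"
  by (simp add: coeff_sum_def)

lemma coeff_sum_diff: "coeff_sum K (f - g) = coeff_sum K f - coeff_sum K g"
  using coeff_sum_add[of K "f - g" g] by simp

text \<open>By linearity \<open>c\<close> may be taken to be a single term; then the two terms of
  the product lie both in \<open>K\<close> or both outside it, and their coefficients
  cancel.\<close>

lemma coeff_sum_mult_binomial:
  fixes c :: "('t, 'r, 'k::field) pol"
  assumes "\<And>w. w + p \<in> K \<longleftrightarrow> w + q \<in> K"
  shows "coeff_sum K (c * (monom_pol p - monom_pol q)) = 0"
proof -
  have 1: "coeff_sum K (Poly_Mapping.single w k * (monom_pol p - monom_pol q)) = 0" for w and k :: 'k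
    using assms by (simp add: monom_pol_def right_diff_distrib mult_single coeff_sum_diff
        coeff_sum_single)
  have sum: "(\<Sum>w\<in>Poly_Mapping.keys c. Poly_Mapping.single w (Poly_Mapping.lookup c w)) = c"
    by (rule poly_mapping_eqI)
      (auto simp: lookup_sum lookup_single when_def in_keys_iff)
  have c: "c * (monom_pol p - monom_pol q) = (\<Sum>w\<in>Poly_Mapping.keys c.
      Poly_Mapping.single w (Poly_Mapping.lookup c w) * (monom_pol p - monom_pol q))"
    by (simp only: sum_distrib_right[symmetric] sum)
  have "coeff_sum K (\<Sum>w\<in>A. Poly_Mapping.single w (Poly_Mapping.lookup c w) *
      (monom_pol p - monom_pol q)) = 0" for A
    by (induction A rule: infinite_finite_induct) (simp_all add: coeff_sum_add 1)
  then show ?thesis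
    unfolding c .
qed

text \<open>An additive measure, positive on nonzero vectors, that supports induction on the degree
  and bounds exponents.\<close>

definition weight :: "nat ^ 'p \<Rightarrow> nat" where
  "weight x = (\<Sum>k\<in>UNIV. x $ k)"

lemma weight_add: "weight (x + y) = weight x + weight y"
  by (simp add: weight_def sum.distrib)

lemma weight_pos: "x \<noteq> 0 \<Longrightarrow> weight x > 0"
  by (auto simp: weight_def vec_eq_iff intro: sum_pos2)

lemma ideal_binomial_step:
  assumes "monom_pol p - monom_pol q \<in> ideal B"
  shows "monom_pol (w + p) - monom_pol (w + q) \<in> ideal B"
  using ring_ideal.span_scale[of "monom_pol p - monom_pol q" B "monom_pol w"] assms
  by (simp add: ideal_def right_diff_distrib monom_pol_mult)

lemma ideal_binomial_trans:
  assumes "monom_pol u - monom_pol v \<in> ideal B" "monom_pol v - monom_pol w \<in> ideal B"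
  shows "monom_pol u - monom_pol w \<in> ideal B"
  using ring_ideal.span_add[of "monom_pol u - monom_pol v" B "monom_pol v - monom_pol w"] assms
  by (simp add: ideal_def)

lemma ideal_binomial_sym:
  assumes "monom_pol u - monom_pol v \<in> ideal B"
  shows "monom_pol v - monom_pol u \<in> ideal B"
  using ring_ideal.span_neg[of "monom_pol u - monom_pol v" B] assms
  by (simp add: ideal_def)

text \<open>Here \<open>rep v\<close> represents the class of \<open>v\<close>, and \<open>ctr v\<close>, which depends only on the degree of \<open>v\<close>,
  is one of the representatives in that degree.\<close>

definition star_binomials ::
  "(('t, 'r) mon \<Rightarrow> ('t, 'r) mon) \<Rightarrow> (('t, 'r) mon \<Rightarrow> ('t, 'r) mon) \<Rightarrow> ('t, 'r, 'k::field) pol set" where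
  "star_binomials ctr rep = {monom_pol (ctr v) - monom_pol (rep v) | v. rep v \<noteq> ctr v}"

text \<open>Induction on the weight of the degree: lower steps lead from each monomial to its
  representative through multiples of binomials already obtained, and the star connects the
  representatives of one degree through the centre.\<close>

lemma star_binomials_generate:
  fixes e :: "'t::finite \<Rightarrow> nat ^ 'p" and a :: "'r::finite \<Rightarrow> nat ^ 'p"
  assumes nz: "\<And>w. w \<noteq> 0 \<Longrightarrow> sdeg e a w \<noteq> 0"
    and rep: "\<And>v. (v, rep v) \<in> (lower_step e a)\<^sup>*"
    and ctr: "\<And>v w. sdeg e a v = sdeg e a w \<Longrightarrow> ctr v = ctr w"
    and d: "sdeg e a u = sdeg e a v"
  shows "monom_pol u - monom_pol v \<in> ideal (star_binomials ctr rep :: ('t, 'r, 'k::field) pol set)"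
  using d
proof (induction "weight (sdeg e a u)" arbitrary: u v rule: less_induct)
  case less
  let ?B = "star_binomials ctr rep :: ('t, 'r, 'k) pol set"
  have chain: "monom_pol x - monom_pol y \<in> ideal ?B"
    if "(x, y) \<in> (lower_step e a)\<^sup>*" "sdeg e a x = sdeg e a u" for x y
    using that
  proof (induction rule: rtrancl_induct)
    case base
    then show ?case by (simp add: ideal_def ring_ideal.span_zero)
  next
    case (step y z)
    obtain w p q where w: "y = w + p" "z = w + q" "w \<noteq> 0" "sdeg e a p = sdeg e a q"
      using step.hyps(2) by (auto simp: lower_step_def)
    \<comment> \<open>Dividing by the nonzero factor \<open>w\<close> lowers the weight, so the
      outer induction hypothesis applies to \<open>p\<close> and \<open>q\<close>.\<close>
    have "sdeg e a u = sdeg e a w + sdeg e a p"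
      using lower_step_sdeg[OF step.hyps(1)] step.prems w(1) by (simp add: sdeg_add)
    then have "weight (sdeg e a p) < weight (sdeg e a u)"
      using weight_pos[OF nz[OF w(3)]] by (simp add: weight_add)
    then have "monom_pol p - monom_pol q \<in> ideal ?B"
      using less.hyps w(4) by blast
    then have "monom_pol y - monom_pol z \<in> ideal ?B"
      unfolding w(1,2) by (rule ideal_binomial_step)
    with step.IH[OF step.prems] show ?case by (rule ideal_binomial_trans)
  qed
  have to_ctr: "monom_pol x - monom_pol (ctr u) \<in> ideal ?B" if "sdeg e a x = sdeg e a u" for x
  proof -
    have "monom_pol (ctr x) - monom_pol (rep x) \<in> ideal ?B"
    proof (cases "rep x = ctr x")
      case True
      then show ?thesis by (simp add: ideal_def ring_ideal.span_zero)
    next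
      case False
      then show ?thesis
        unfolding ideal_def by (intro ring_ideal.span_base) (auto simp: star_binomials_def)
    qed
    then have "monom_pol (rep x) - monom_pol (ctr u) \<in> ideal ?B"
      unfolding ctr[OF that] by (rule ideal_binomial_sym)
    with chain[OF rep that] show ?thesis by (rule ideal_binomial_trans)
  qed
  show ?case
    by (rule ideal_binomial_trans[OF to_ctr[OF refl] ideal_binomial_sym[OF to_ctr]])
      (simp add: less.prems)
qed

text \<open>Only one generator connects a non-central class to the rest of its degree, so summing
  coefficients over that class separates this generator from the ideal of the others.\<close>

lemma star_binomials_minimal:
  fixes e :: "'t::finite \<Rightarrow> nat ^ 'p" and a :: "'r::finite \<Rightarrow> nat ^ 'p"
  assumes nz: "\<And>w. w \<noteq> 0 \<Longrightarrow> sdeg e a w \<noteq> 0"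
    and rep: "\<And>v. (v, rep v) \<in> (lower_step e a)\<^sup>*"
    and rep_eq: "\<And>v w. (v, w) \<in> (lower_step e a)\<^sup>* \<Longrightarrow> rep v = rep w"
    and ctr: "\<And>v w. sdeg e a v = sdeg e a w \<Longrightarrow> ctr v = ctr w"
    and ctr_sdeg: "\<And>v. sdeg e a (ctr v) = sdeg e a v"
    and rep_ctr: "\<And>v. rep (ctr v) = ctr v"
  shows "minimal_binomial_generating_set e a (star_binomials ctr rep :: ('t, 'r, 'k::field) pol set)"
proof -
  let ?B = "star_binomials ctr rep :: ('t, 'r, 'k) pol set"
  have rep_sdeg: "sdeg e a (rep v) = sdeg e a v" for v
    using lower_step_sdeg[OF rep[of v]] by simp
  have sub: "?B \<subseteq> binomials e a"
    using ctr_sdeg rep_sdeg by (auto simp: star_binomials_def binomials_def) metis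
  have gen: "ideal ?B = semigroup_ideal e a"
  proof
    show "ideal ?B \<subseteq> semigroup_ideal e a"
      unfolding ideal_def semigroup_ideal_def using sub by (rule ring_ideal.span_mono)
    have "binomials e a \<subseteq> ideal ?B"
      using star_binomials_generate[OF nz rep ctr] by (auto simp: binomials_def)
    then show "semigroup_ideal e a \<subseteq> ideal ?B"
      unfolding ideal_def semigroup_ideal_def
      by (simp add: ring_ideal.span_minimal)
  qed
  have "ideal B' \<noteq> semigroup_ideal e a" if B': "B' \<subset> ?B" for B'
  proof
    assume eq: "ideal B' = semigroup_ideal e a"
    obtain v where v: "rep v \<noteq> ctr v" "monom_pol (ctr v) - monom_pol (rep v) \<notin> B'"
      using B' by (auto simp: star_binomials_def)
    \<comment> \<open>By \<open>rep\<close> and \<open>rep_eq\<close> this is the class of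
      \<open>v\<close>; as \<open>rep v \<noteq> ctr v\<close>, the centre of the degree lies
      outside it.\<close>
    define K where "K = {z. rep z = rep v}"
    have "coeff_sum K f = 0" if "f \<in> ring_ideal.span B'" for f
      using that
    proof (induction rule: ring_ideal.span_induct_alt)
      case base
      then show ?case by simp
    next
      case (step c b f)
      obtain v' where v': "rep v' \<noteq> ctr v'" "b = monom_pol (ctr v') - monom_pol (rep v')"
        using step(1) B' by (auto simp: star_binomials_def)
      have "w + ctr v' \<in> K \<longleftrightarrow> w + rep v' \<in> K" for w
      proof (cases "w = 0")
        case False
        then have "rep (w + ctr v') = rep (w + rep v')"
          using rep_eq lower_stepI ctr_sdeg rep_sdeg by metis
        then show ?thesis by (simp add: K_def)
      next
        case True
        \<comment> \<open>The unmultiplied generator misses \<open>K\<close> at both ends: a centre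
          in \<open>K\<close> would make \<open>rep v\<close> the centre of its degree, and an outer
          end in \<open>K\<close> would make \<open>b\<close> the removed binomial.\<close>
        have "rep (ctr v') \<noteq> rep v"
          by (metis rep_ctr rep_sdeg ctr ctr_sdeg v(1))
        moreover have "rep (rep v') \<noteq> rep v"
          by (metis rep_eq rep rep_sdeg ctr v(2) v'(2) step(1))
        ultimately show ?thesis using True by (simp add: K_def)
      qed
      then show ?case
        using step v'(2) by (simp add: coeff_sum_add coeff_sum_mult_binomial)
    qed
    \<comment> \<open>Of the two terms only \<open>rep v\<close>, with coefficient
      \<open>- 1\<close>, lies in \<open>K\<close>.\<close>
    moreover have "coeff_sum K (monom_pol (ctr v) - monom_pol (rep v) :: ('t, 'r, 'k) pol) = - 1"
      using v(1) rep_ctr rep_eq[OF rep[of v]]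
      by (simp add: monom_pol_def coeff_sum_diff coeff_sum_single K_def)
    moreover have "monom_pol (ctr v) - monom_pol (rep v) \<in> ideal B'"
      unfolding eq gen[symmetric] using v(1)
      unfolding ideal_def by (intro ring_ideal.span_base) (auto simp: star_binomials_def)
    ultimately show False by (auto simp: ideal_def)
  qed
  then show ?thesis
    using sub gen by (auto simp: minimal_binomial_generating_set_def)
qed

text \<open>A minimal generating set is built whose representatives avoid \<open>u\<close> whenever
  the class of \<open>u\<close> has another element; a proper divisor with nontrivial fibre provides
  such an element.\<close>

lemma indispensable_imp_minimal_nontrivial:
  fixes e :: "'t::finite \<Rightarrow> nat ^ 'p" and a :: "'r::finite \<Rightarrow> nat ^ 'p"
  assumes nz: "\<And>w. w \<noteq> 0 \<Longrightarrow> sdeg e a w \<noteq> 0"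
    and ind: "indispensable TYPE('k::field) e a u"
  shows "minimal_nontrivial e a u"
proof (rule ccontr)
  assume not_min: "\<not> minimal_nontrivial e a u"
  define cls where "cls v = {z. (v, z) \<in> (lower_step e a)\<^sup>*}" for v
  \<comment> \<open>\<open>u\<close> is chosen only from the class \<open>{u}\<close>. Choosing from
    the set rather than from a member gives equivalent monomials the same representative.\<close>
  define pick where "pick X = (SOME z. z \<in> X \<and> (z = u \<longrightarrow> X = {u}))" for X :: "('t, 'r) mon set"
  define rep where "rep v = pick (cls v)" for v
  \<comment> \<open>A choice made from the degree alone, followed by \<open>rep\<close>, makes the
    centre constant on each degree and its own representative.\<close>
  define ctr where "ctr v = rep (SOME z. sdeg e a z = sdeg e a v)" for v
  have cls_eq: "cls v = cls w" if "(v, w) \<in> (lower_step e a)\<^sup>*" for v w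
    using that symD[OF sym_lower_step[of e a]] by (auto simp: cls_def intro: rtrancl_trans)
  have self: "v \<in> cls v" for v by (simp add: cls_def)
  have pick: "rep v \<in> cls v \<and> (rep v = u \<longrightarrow> cls v = {u})" for v
  proof -
    have "\<exists>z. z \<in> cls v \<and> (z = u \<longrightarrow> cls v = {u})"
      using self[of v] by blast
    then show ?thesis unfolding rep_def pick_def by (rule someI_ex)
  qed
  have rep: "(v, rep v) \<in> (lower_step e a)\<^sup>*" for v
    using pick by (simp add: cls_def)
  have rep_eq: "rep v = rep w" if "(v, w) \<in> (lower_step e a)\<^sup>*" for v w
    using cls_eq[OF that] by (simp add: rep_def)
  have ctr: "ctr v = ctr w" if "sdeg e a v = sdeg e a w" for v w
    using that by (simp add: ctr_def)
  have ctr_sdeg: "sdeg e a (ctr v) = sdeg e a v" for v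
  proof -
    have "sdeg e a (SOME z. sdeg e a z = sdeg e a v) = sdeg e a v"
      by (rule someI) (rule refl)
    then show ?thesis unfolding ctr_def using lower_step_sdeg[OF rep] by metis
  qed
  have rep_ctr: "rep (ctr v) = ctr v" for v
    unfolding ctr_def by (rule rep_eq[OF rep, symmetric])
  have mbg: "minimal_binomial_generating_set e a (star_binomials ctr rep :: ('t, 'r, 'k) pol set)"
    by (rule star_binomials_minimal[where e = e and a = a and rep = rep and ctr = ctr,
          OF nz rep rep_eq ctr ctr_sdeg rep_ctr])
  obtain b where b: "b \<in> (star_binomials ctr rep :: ('t, 'r, 'k) pol set)"
    "u \<in> Poly_Mapping.keys b"
    using ind[unfolded indispensable_def, rule_format, OF mbg] by (elim bexE)
  \<comment> \<open>Occurrence in a generator gives \<open>u\<close> a nontrivial fibre, so the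
    failure of minimality must come from a proper divisor.\<close>
  have "b \<in> binomials e a"
    using mbg b(1) unfolding minimal_binomial_generating_set_def by (elim conjE) (rule subsetD)
  then have "nontrivial_fibre e a u"
    using b(2) by (rule binomial_keys_nontrivial)
  then obtain w p where wp: "u = w + p" "nontrivial_fibre e a p" "w \<noteq> 0"
    using not_min by (auto simp: minimal_nontrivial_def)
  then obtain q where q: "q \<noteq> p" "sdeg e a p = sdeg e a q"
    by (auto simp: nontrivial_fibre_def)
  then have "w + q \<in> cls u" "w + q \<noteq> u"
    using lower_stepI[OF wp(3) q(2)] wp(1) by (auto simp: cls_def)
  then have "cls u \<noteq> {u}" by blast
  \<comment> \<open>Centres are representatives too, so either end of \<open>b\<close> has this
    form.\<close>
  moreover obtain v where "u = rep v"
  proof -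
    obtain v where "b = monom_pol (ctr v) - monom_pol (rep v)" "rep v \<noteq> ctr v"
      using b(1) by (auto simp: star_binomials_def)
    then have "u = ctr v \<or> u = rep v"
      using b(2) keys_monom_diff[of "ctr v" "rep v"] by auto
    then show thesis using that[of v] that[of "SOME z. sdeg e a z = sdeg e a v"]
      by (auto simp: ctr_def)
  qed
  ultimately show False
    using pick[of v] cls_eq[OF rep[of v]] by auto
qed


section \<open>Minimal monomials involving the non-multiplicity generators\<close>

text \<open>Each occurrence of a variable adds at least 1 to the weight of the degree, so all
  exponents are bounded by \<open>weight m\<close> and the fibre embeds into a finite box.\<close>

lemma finite_fibre:
  fixes e :: "'t::finite \<Rightarrow> nat ^ 'p" and a :: "'r::finite \<Rightarrow> nat ^ 'p"
  assumes nz: "\<And>w. w \<noteq> 0 \<Longrightarrow> sdeg e a w \<noteq> 0"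
  shows "finite (C e a m)"
proof -
  have bound: "Poly_Mapping.lookup u x \<le> weight (sdeg e a u)" for u x
  proof (induction "Poly_Mapping.lookup u x" arbitrary: u)
    case 0
    then show ?case by simp
  next
    case (Suc n)
    have "Poly_Mapping.lookup (Poly_Mapping.single x 1) y \<le> Poly_Mapping.lookup u y" for y
      using Suc.hyps(2) by (auto simp: lookup_single when_def)
    then obtain w where w: "u = w + Poly_Mapping.single x 1" by (rule mon_splitI)
    have "Poly_Mapping.single x (1::nat) \<noteq> 0" by (metis one_neq_zero lookup_single_eq lookup_zero)
    then have "weight (sdeg e a (Poly_Mapping.single x 1)) > 0"
      using nz weight_pos by blast
    moreover have "n = Poly_Mapping.lookup w x"
      using Suc.hyps(2) w by (simp add: lookup_add)
    ultimately show ?case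
      using Suc.hyps(1)[of w] Suc.hyps(2) w by (simp add: sdeg_add weight_add)
  qed
  have "Poly_Mapping.lookup ` C e a m \<subseteq> (UNIV :: ('t + 'r) set) \<rightarrow>\<^sub>E {..weight m}"
    using bound by (auto simp: C_def)
  then have "finite (Poly_Mapping.lookup ` C e a m)"
    by (rule finite_subset) (auto intro: finite_PiE)
  then show ?thesis
    by (rule finite_imageD) (simp add: inj_on_def)
qed

lemma nontrivial_fibre_iff_card:
  assumes nz: "\<And>w. w \<noteq> 0 \<Longrightarrow> sdeg e a w \<noteq> 0"
  shows "nontrivial_fibre e a u \<longleftrightarrow> card (C e a (sdeg e a u)) \<ge> 2"
    and "\<not> nontrivial_fibre e a u \<longleftrightarrow> card (C e a (sdeg e a u)) = 1"
proof -
  have fin: "finite (C e a (sdeg e a u))" using nz by (rule finite_fibre)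
  have u: "u \<in> C e a (sdeg e a u)" by (simp add: C_def)
  have "card (C e a (sdeg e a u)) = 1 \<longleftrightarrow> C e a (sdeg e a u) = {u}"
    using u by (auto simp: card_1_singleton_iff)
  also have "\<dots> \<longleftrightarrow> \<not> nontrivial_fibre e a u"
    using u by (auto simp: nontrivial_fibre_def C_def)
  finally show 1: "\<not> nontrivial_fibre e a u \<longleftrightarrow> card (C e a (sdeg e a u)) = 1" by simp
  \<comment> \<open>Finiteness excludes the default value 0 of \<open>card\<close> on infinite
    sets.\<close>
  have "card (C e a (sdeg e a u)) \<noteq> 0" using fin u by auto
  then show "nontrivial_fibre e a u \<longleftrightarrow> card (C e a (sdeg e a u)) \<ge> 2"
    using 1 by linarith
qed

lemma mem_T_iff:
  assumes nz: "\<And>w. w \<noteq> 0 \<Longrightarrow> sdeg e a w \<noteq> 0"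
  shows "\<alpha> \<in> T e a j \<longleftrightarrow>
    nontrivial_fibre e a (xpow \<alpha> + yvar j) \<and> \<not> nontrivial_fibre e a (xpow \<alpha>)"
  unfolding T_def
  using nontrivial_fibre_iff_card(1)[OF nz, of "xpow \<alpha> + yvar j"]
    nontrivial_fibre_iff_card(2)[OF nz, of "xpow \<alpha>"]
  by (simp add: sdeg_add sdeg_xpow)

lemma xpow_le_split:
  fixes \<alpha> \<beta> :: "nat ^ 't::finite"
  assumes "\<alpha> \<le> \<beta>"
  shows "xpow \<beta> = xpow (\<beta> - \<alpha>) + (xpow \<alpha> :: ('t, 'r) mon)"
  using assms by (intro mon_eqI) (auto simp: lookup_add less_eq_vec_def)

lemma mon_without_y:
  assumes "\<And>j. Poly_Mapping.lookup u (Inr j) = 0"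
  shows "u = xpow (\<chi> i. Poly_Mapping.lookup u (Inl i))"
  using assms by (intro mon_eqI) auto

lemma mon_y_split:
  assumes "Poly_Mapping.lookup u (Inr j) \<noteq> 0"
  obtains v where "u = v + yvar j"
  by (rule mon_splitI[of "yvar j" u])
    (use assms in \<open>auto simp: yvar_def lookup_single when_def\<close>)

text \<open>A divisor free of \<open>yvar j\<close> divides \<open>xpow \<omega>\<close>, whose
  fibre is trivial. Any other divisor with nontrivial fibre is \<open>xpow \<alpha> + yvar j\<close>
  with \<alpha> \<le> \<omega> in \<open>T e a j\<close>, and minimality of \<omega> leaves no
  cofactor.\<close>

lemma minimal_nontrivial_xpow_yvar:
  assumes nz: "\<And>w. w \<noteq> 0 \<Longrightarrow> sdeg e a w \<noteq> 0"
    and \<omega>: "\<omega> \<in> Hilb (T e a j)"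
  shows "minimal_nontrivial e a (xpow \<omega> + yvar j)"
proof -
  have \<omega>T: "nontrivial_fibre e a (xpow \<omega> + yvar j)" "\<not> nontrivial_fibre e a (xpow \<omega>)"
    using \<omega> mem_T_iff[OF nz] by (auto simp: Hilb_def)
  have "w = 0" if eq: "xpow \<omega> + yvar j = w + p" and p: "nontrivial_fibre e a p" for w p
  proof -
    have lk: "Poly_Mapping.lookup (xpow \<omega> + yvar j) x = Poly_Mapping.lookup w x + Poly_Mapping.lookup p x" for x
      unfolding eq by (rule lookup_add)
    show ?thesis
    proof (cases "Poly_Mapping.lookup p (Inr j) = 0")
      case True
      then have "Poly_Mapping.lookup w (Inr j) \<noteq> 0"
        using lk[of "Inr j"] by (simp add: lookup_add)
      then obtain w' where "w = w' + yvar j" by (rule mon_y_split)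
      then have "xpow \<omega> + yvar j = (w' + p) + yvar j" using eq by (simp add: add_ac)
      then have "xpow \<omega> = w' + p" by (rule add_right_imp_eq)
      then show ?thesis using \<omega>T(2) p nontrivial_fibre_add by metis
    next
      case False
      then obtain p' where p': "p = p' + yvar j" by (rule mon_y_split)
      then have "xpow \<omega> + yvar j = (w + p') + yvar j" using eq by (simp add: add_ac)
      then have eq': "xpow \<omega> = w + p'" by (rule add_right_imp_eq)
      have lk': "Poly_Mapping.lookup (xpow \<omega>) x = Poly_Mapping.lookup w x + Poly_Mapping.lookup p' x" for x
        unfolding eq' by (rule lookup_add)
      define \<alpha> where "\<alpha> = (\<chi> i. Poly_Mapping.lookup p' (Inl i))"
      have "p' = xpow \<alpha>"
        unfolding \<alpha>_def using lk'[of "Inr _"] by (intro mon_without_y) simp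
      moreover from this have "\<not> nontrivial_fibre e a (xpow \<alpha>)"
        using \<omega>T(2) eq' nontrivial_fibre_add by metis
      ultimately have "\<alpha> \<in> T e a j"
        using p p' mem_T_iff[OF nz] by metis
      moreover have "\<alpha> \<le> \<omega>"
        using lk'[of "Inl _"] by (simp add: \<alpha>_def less_eq_vec_def)
      ultimately have "\<alpha> = \<omega>" using \<omega> by (auto simp: Hilb_def)
      then show ?thesis using eq' \<open>p' = xpow \<alpha>\<close> by simp
    qed
  qed
  then show ?thesis using \<omega>T(1) by (auto simp: minimal_nontrivial_def)
qed

text \<open>A product of two \<open>yvar\<close> factors dividing \<open>u\<close> has a nontrivial
  fibre and so equals \<open>u\<close>. With just one such factor, the remaining
  \<open>xpow \<omega>\<close> is a proper divisor and has a trivial fibre, and an element of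
  \<open>T e a j\<close> strictly below \<omega> would contradict minimality.\<close>

lemma minimal_nontrivial_yvar_cases:
  fixes e :: "'t::finite \<Rightarrow> nat ^ 'p" and a :: "'r::finite \<Rightarrow> nat ^ 'p"
  assumes nz: "\<And>w. w \<noteq> 0 \<Longrightarrow> sdeg e a w \<noteq> 0"
    and yy: "\<And>i j. nontrivial_fibre e a (yvar i + yvar j)"
    and u: "minimal_nontrivial e a u" "Poly_Mapping.lookup u (Inr j) \<noteq> 0"
  shows "(\<exists>i j. u = yvar i + yvar j) \<or> (\<exists>j. \<exists>\<omega>\<in>Hilb (T e a j). u = xpow \<omega> + yvar j)"
proof -
  have min: "w = 0" if "u = w + p" "nontrivial_fibre e a p" for w p
    using u(1) that by (auto simp: minimal_nontrivial_def)
  obtain v where v: "u = v + yvar j" using u(2) by (rule mon_y_split)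
  show ?thesis
  proof (cases "\<exists>i. Poly_Mapping.lookup v (Inr i) \<noteq> 0")
    case True
    then obtain i w where "v = w + yvar i" using mon_y_split by metis
    then have "u = w + (yvar i + yvar j)" using v by (simp add: add.assoc)
    moreover from this have "w = 0" using min yy by blast
    ultimately show ?thesis by auto
  next
    case False
    define \<omega> where "\<omega> = (\<chi> i. Poly_Mapping.lookup v (Inl i))"
    have v\<omega>: "v = xpow \<omega>"
      unfolding \<omega>_def using False by (intro mon_without_y) simp
    have "\<not> nontrivial_fibre e a v"
      using min[of "yvar j" v] v by (auto simp: add.commute)
    then have "\<omega> \<in> T e a j"
      using u(1) v v\<omega> mem_T_iff[OF nz] by (metis minimal_nontrivial_def)
    moreover have "\<alpha> = \<omega>" if \<alpha>: "\<alpha> \<in> T e a j" "\<alpha> \<le> \<omega>" for \<alpha>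
    proof -
      have "u = xpow (\<omega> - \<alpha>) + (xpow \<alpha> + yvar j)"
        using v v\<omega> xpow_le_split[OF \<alpha>(2)] by (metis add.assoc)
      moreover have "nontrivial_fibre e a (xpow \<alpha> + yvar j)"
        using \<alpha>(1) mem_T_iff[OF nz] by blast
      ultimately have "xpow (\<omega> - \<alpha>) = (0 :: ('t, 'r) mon)" by (rule min)
      then have "(\<omega> - \<alpha>) $ i = 0" for i
        by (metis lookup_xpow(1) lookup_zero)
      then show ?thesis using \<alpha>(2) by (auto simp: vec_eq_iff less_eq_vec_def intro: antisym)
    qed
    ultimately have "\<omega> \<in> Hilb (T e a j)" by (auto simp: Hilb_def)
    then show ?thesis using v v\<omega> by blast
  qed
qed

text \<open>A proper divisor of the product divides one of the two variables, whose fibre is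
  trivial.\<close>

lemma minimal_nontrivial_yvar_yvar:
  fixes e :: "'t::finite \<Rightarrow> nat ^ 'p" and a :: "'r::finite \<Rightarrow> nat ^ 'p"
  assumes "nontrivial_fibre e a (yvar i + yvar j)"
    and y: "\<And>j. \<not> nontrivial_fibre e a (yvar j)"
  shows "minimal_nontrivial e a (yvar i + yvar j)"
proof -
  have "w = 0" if eq: "yvar i + yvar j = w + p" and p: "nontrivial_fibre e a p" for w p
  proof (rule ccontr)
    assume "w \<noteq> 0"
    then obtain x w' where w: "w = w' + Poly_Mapping.single x 1" by (rule mon_neq_0_split)
    have "Poly_Mapping.lookup (yvar i + yvar j :: ('t, 'r) mon) x \<noteq> 0"
      unfolding eq w by (simp add: lookup_add)
    \<comment> \<open>A variable of the cofactor must be one of the two factors; \<open>l\<close>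
      indexes the other.\<close>
    then obtain k l where "(x = Inr k) \<and> yvar i + yvar j = yvar k + (yvar l :: ('t, 'r) mon)"
      by (cases x) (auto simp: lookup_add add.commute split: if_splits)
    then have "yvar k + yvar l = yvar k + (w' + p)"
      using eq w by (simp add: yvar_def algebra_simps)
    then have "yvar l = w' + p" by simp
    then show False using y p nontrivial_fibre_add by metis
  qed
  then show ?thesis using assms(1) by (auto simp: minimal_nontrivial_def)
qed

section \<open>From the semigroup to the degree map\<close>

lemma sdeg_mem_submonoid:
  assumes "submonoid S" "range e \<subseteq> S" "range a \<subseteq> S"
  shows "sdeg e a u \<in> S"
  \<comment> \<open>Giving every variable degree 1 makes \<open>sdeg\<close> measure the total degree of a monomial.\<close>
proof (induction "weight (sdeg (\<lambda>_. 1 :: nat ^ 1) (\<lambda>_. 1) u)" arbitrary: u rule: less_induct)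
  case less
  show ?case
  proof (cases "u = 0")
    case True
    then show ?thesis using assms by (simp add: submonoid_def)
  next
    case False
    then obtain x w where w: "u = w + Poly_Mapping.single x 1" by (rule mon_neq_0_split)
    have "sdeg e a w \<in> S"
      by (rule less) (cases x; simp add: w sdeg_add weight_add weight_def)
    moreover have "sdeg e a (Poly_Mapping.single x 1) \<in> S"
      using assms(2,3) by (cases x) (auto simp: vector_scalar_mult_def)
    ultimately show ?thesis using assms(1) by (simp add: w sdeg_add submonoid_def)
  qed
qed

lemma msg_eq_irreducibles:
  fixes S :: "(nat ^ 'p) set"
  assumes "submonoid S"
  shows "msg S = {x \<in> S - {0}. \<not> (\<exists>y\<in>S - {0}. \<exists>z\<in>S - {0}. x = y + z)}"
  using minimal_generating_set_msg minimal_generating_set_unique assms by blast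

theorem corollary30:
  fixes S :: "(nat ^ 'p::finite) set"
    and e :: "'t::finite \<Rightarrow> nat ^ 'p"
    and a :: "'r::finite \<Rightarrow> nat ^ 'p"
  assumes "affine_semigroup S"
    and "special_strong S"
    and "inj e" and "range e = Mult S"
    and "inj a" and "range a = msg S - Mult S"
  shows "(\<forall>i j. indispensable TYPE('k::field) e a (yvar i + yvar j)) \<and>
    (\<forall>j. \<forall>\<omega>\<in>Hilb (T e a j). indispensable TYPE('k) e a (xpow \<omega> + yvar j)) \<and>
    (\<forall>u. indispensable TYPE('k) e a u \<and> (\<exists>j. Poly_Mapping.lookup u (Inr j) \<noteq> 0) \<longrightarrow>
       (\<exists>i j. u = yvar i + yvar j) \<or>
       (\<exists>j. \<exists>\<omega>\<in>Hilb (T e a j). u = xpow \<omega> + yvar j))"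
proof -
  have sub: "submonoid S" using assms(1) by (simp add: affine_semigroup_def)
  have e: "e i \<in> S - {0}" for i using assms(4) unfolding Mult_def by blast
  have a: "a j \<in> msg S" "a j \<notin> Mult S" for j using assms(6) by auto
  have irred: "a j \<in> S - {0}" "\<not> (\<exists>y\<in>S - {0}. \<exists>z\<in>S - {0}. a j = y + z)" for j
    using a(1)[of j] unfolding msg_eq_irreducibles[OF sub] by blast+
  have gen: "sdeg e a (Poly_Mapping.single x 1) \<noteq> 0" for x
    using e irred(1) by (cases x) (auto simp: vec_eq_iff)
  have nz: "sdeg e a w \<noteq> 0" if w: "w \<noteq> 0" for w
  proof -
    obtain x v where x: "w = v + Poly_Mapping.single x 1" using w by (rule mon_neq_0_split)
    have "weight (sdeg e a w) > 0"
      using weight_pos[OF gen[of x]] unfolding x sdeg_add weight_add by simp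
    then show ?thesis by (auto simp: weight_def)
  qed
  have mem: "sdeg e a u \<in> S" for u
    by (rule sdeg_mem_submonoid[OF sub]) (use e irred(1) in blast)+
  \<comment> \<open>The degrees form a submonoid containing \<open>msg S\<close>, which generates
    \<open>S\<close>.\<close>
  have surj: "\<exists>u. s = sdeg e a u" if "s \<in> S" for s
  proof -
    have "submonoid (range (sdeg e a))"
      using rangeI[of "sdeg e a" 0] by (auto simp: submonoid_def simp flip: sdeg_add)
    moreover have "msg S \<subseteq> range (sdeg e a)"
    proof
      fix x assume "x \<in> msg S"
      then have "x \<in> range e \<union> range a" using assms(4,6) by auto
      moreover have "e i = sdeg e a (Poly_Mapping.single (Inl i) 1)" for i
        by (simp add: vec_eq_iff)
      moreover have "a j = sdeg e a (yvar j)" for j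
        by simp
      ultimately show "x \<in> range (sdeg e a)" by blast
    qed
    ultimately have "submonoid hull msg S \<subseteq> range (sdeg e a)"
      by (rule hull_minimal[rotated])
    then show ?thesis
      using that minimal_generating_set_msg[OF sub] unfolding minimal_generating_set_def by blast
  qed
  \<comment> \<open>Split a variable off a monomial \<open>v\<close> of degree \<open>a j\<close>:
    irreducibility of \<open>a j\<close> gives the cofactor degree 0, so \<open>v\<close> is a
    single variable. It is not an \<open>Inl\<close> variable because \<open>a j\<close> is no
    multiplicity, and injectivity of \<open>a\<close> makes it \<open>yvar j\<close>.\<close>
  have y: "\<not> nontrivial_fibre e a (yvar j)" for j
  proof
    assume "nontrivial_fibre e a (yvar j)"
    then obtain v where v: "v \<noteq> yvar j" "sdeg e a v = a j"
      by (auto simp: nontrivial_fibre_def)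
    then have "v \<noteq> 0" using irred(1)[of j] by auto
    then obtain x w where w: "v = w + Poly_Mapping.single x 1" by (rule mon_neq_0_split)
    then have eq: "a j = sdeg e a w + sdeg e a (Poly_Mapping.single x 1)"
      using v(2) by (simp only: sdeg_add)
    then have "sdeg e a w = 0"
      using irred(2)[of j] mem gen[of x] by blast
    then have "w = 0" using nz by blast
    then have x: "a j = sdeg e a (Poly_Mapping.single x 1)" "v = Poly_Mapping.single x 1"
      using eq w by simp_all
    show False
    proof (cases x)
      case (Inl i)
      then have "a j = e i" using x(1) by (simp add: vec_eq_iff)
      then show False using a(2)[of j] assms(4) by auto
    next
      case (Inr k)
      then have "a j = a k" using x(1) by (simp add: vec_eq_iff)
      then have "k = j" using assms(5) by (simp add: inj_eq)
      then show False using v(1) x(2) Inr by (simp add: yvar_def)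
    qed
  qed
  \<comment> \<open>The special strong property rewrites \<open>a i + a j\<close> as a multiplicity
    \<open>e k\<close> plus an element of \<open>S\<close>; this gives a second monomial, which
    differs by containing the variable \<open>Inl k\<close>.\<close>
  have yy: "nontrivial_fibre e a (yvar i + yvar j)" for i j
  proof -
    obtain m s where "m \<in> Mult S" "s \<in> S" "a i + a j = m + s"
      using assms(2) irred(1)[of i] irred(1)[of j] unfolding special_strong_def by blast
    moreover then obtain k u where "m = e k" "s = sdeg e a u"
      using assms(4) surj by blast
    ultimately have "sdeg e a (Poly_Mapping.single (Inl k) 1 + u) = sdeg e a (yvar i + yvar j)"
      by (simp add: sdeg_add vec_eq_iff)
    moreover have "Poly_Mapping.single (Inl k) 1 + u \<noteq> yvar i + yvar j"
      by (metis add_is_0 lookup_add lookup_single_eq lookup_yvar(1) one_neq_zero)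
    ultimately show ?thesis unfolding nontrivial_fibre_def by blast
  qed
  have "minimal_nontrivial e a u" if "indispensable TYPE('k) e a u" for u
    using nz that by (rule indispensable_imp_minimal_nontrivial)
  then have ind: "indispensable TYPE('k) e a u \<longleftrightarrow> minimal_nontrivial e a u" for u
    using minimal_nontrivial_imp_indispensable by blast
  have "minimal_nontrivial e a (xpow \<omega> + yvar j)" if "\<omega> \<in> Hilb (T e a j)" for \<omega> j
    using nz that by (rule minimal_nontrivial_xpow_yvar)
  moreover have "(\<exists>i j. u = yvar i + yvar j) \<or> (\<exists>j. \<exists>\<omega>\<in>Hilb (T e a j). u = xpow \<omega> + yvar j)"
    if "minimal_nontrivial e a u" "Poly_Mapping.lookup u (Inr j) \<noteq> 0" for u j
    using nz yy that by (rule minimal_nontrivial_yvar_cases)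
  ultimately show ?thesis
    unfolding ind using minimal_nontrivial_yvar_yvar[OF yy y] by blast
qed

end
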